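(* Let $(F,d)$ be an ordinary differential field of characteristic zero with constant field $C\neq F$, and let $n>1$. The system $x,dx,d^2x,\dots,d^nx$ (i.e. the $n(n+1)$ elements $d^jx_i$, $0\le j\le n$, $1\le i\le n$) is algebraically independent over $C\langle x,d\rangle^{GL(n,C)\propto C^n}$, and $$C\langle x,d\rangle=C\langle x,d\rangle^{GL(n,C)\propto C^n}(x,dx,d^2x,\dots,d^nx).$$
   Context: $x$ is the column vector of $x_1,\dots,x_n$, which are $d$-differentially algebraically independent over $F$. $C\langle x,d\rangle$ is the field of differential rational functions in $x_1,\dots,x_n$ over $C$, i.e. the field of fractions of $C\{x,d\}=C[x,dx,d^2x,\dots]$. $GL(n,C)\propto C^n$ is the affine group, acting by $x\mapsto hx+h_0$, and $C\langle x,d\rangle^{GL(n,C)\propto C^n}$ is the field of all $f^d\langle x\rangle\in C\langle x,d\rangle$ with $f^d\langle hx+h_0\rangle=f^d\langle x\rangle$ for all $(h,h_0)\in GL(n,C)\propto C^n$ (where $f^d\langle hx+h_0\rangle$ is the result of replacing $x$ by $hx+h_0$ in $f$). For a field $L$, $L(x,dx,\dots,d^nx)$ denotes the field generated over $L$ (without derivations) by the components of $x,dx,\dots,d^nx$. *)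

theory Defs
  imports "HOL-Analysis.Determinants" "HOL-Library.Poly_Mapping"
begin

definition is_subfield :: "'a::field set \<Rightarrow> bool" where
  "is_subfield L \<longleftrightarrow>
     0 \<in> L \<and> 1 \<in> L \<and>
     (\<forall>a\<in>L. \<forall>b\<in>L. a + b \<in> L \<and> a * b \<in> L) \<and>
     (\<forall>a\<in>L. - a \<in> L \<and> inverse a \<in> L)"

definition adjoin :: "'a::field set \<Rightarrow> 'a set \<Rightarrow> 'a set" where
  "adjoin L S = is_subfield hull (L \<union> S)"

definition is_derivation :: "('a::comm_ring_1 \<Rightarrow> 'a) \<Rightarrow> bool" where
  "is_derivation d \<longleftrightarrow>
     (\<forall>a b. d (a + b) = d a + d b) \<and> (\<forall>a b. d (a * b) = d a * b + a * d b)"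

definition constants :: "('a::comm_ring_1 \<Rightarrow> 'a) \<Rightarrow> 'a set \<Rightarrow> 'a set" where
  "constants d F = {c \<in> F. d c = 0}"

text \<open>
  A polynomial in variables indexed by \<open>'v\<close> is a finitely supported map from monomials
  (finitely supported exponent functions) to coefficients.
\<close>

type_synonym ('v, 'a) mpol = "('v \<Rightarrow>\<^sub>0 nat) \<Rightarrow>\<^sub>0 'a"

definition mpol_over :: "'a::zero set \<Rightarrow> 'v set \<Rightarrow> ('v, 'a) mpol set" where
  "mpol_over L I =
     {p. (\<forall>m. Poly_Mapping.lookup p m \<in> L) \<and>
         (\<forall>m \<in> Poly_Mapping.keys p. Poly_Mapping.keys m \<subseteq> I)}"

definition mpol_eval :: "('v \<Rightarrow> 'a::comm_ring_1) \<Rightarrow> ('v, 'a) mpol \<Rightarrow> 'a" where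
  "mpol_eval y p = (\<Sum>m\<in>Poly_Mapping.keys p. Poly_Mapping.lookup p m *
       (\<Prod>v\<in>Poly_Mapping.keys m. y v ^ Poly_Mapping.lookup m v))"

definition alg_indep_over :: "'a::comm_ring_1 set \<Rightarrow> 'v set \<Rightarrow> ('v \<Rightarrow> 'a) \<Rightarrow> bool" where
  "alg_indep_over L I y \<longleftrightarrow> (\<forall>p \<in> mpol_over L I. mpol_eval y p = 0 \<longrightarrow> p = 0)"

text \<open>
  The variable \<open>(i, j)\<close> of a differential polynomial stands for the \<open>j\<close>-th derivative of the
  \<open>i\<close>-th indeterminate.
\<close>

definition jet :: "('a \<Rightarrow> 'a) \<Rightarrow> 'a ^ 'n \<Rightarrow> 'n \<times> nat \<Rightarrow> 'a" where
  "jet d y = (\<lambda>(i, j). (d ^^ j) (y $ i))"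

definition diff_eval ::
  "('a::comm_ring_1 \<Rightarrow> 'a) \<Rightarrow> ('n \<times> nat, 'a) mpol \<Rightarrow> 'a ^ 'n \<Rightarrow> 'a" where
  "diff_eval d p y = mpol_eval (jet d y) p"

definition diff_alg_indep :: "('a::comm_ring_1 \<Rightarrow> 'a) \<Rightarrow> 'a set \<Rightarrow> 'a ^ 'n \<Rightarrow> bool" where
  "diff_alg_indep d F x \<longleftrightarrow> alg_indep_over F UNIV (jet d x)"

definition diff_rational_functions ::
  "('a::field \<Rightarrow> 'a) \<Rightarrow> 'a set \<Rightarrow> 'a ^ 'n \<Rightarrow> 'a set" where
  "diff_rational_functions d C x =
     {diff_eval d p x / diff_eval d q x | p q.
        p \<in> mpol_over C UNIV \<and> q \<in> mpol_over C UNIV \<and> diff_eval d q x \<noteq> 0}"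

definition GL_over :: "'a::field set \<Rightarrow> ('a ^ 'n ^ 'n) set" where
  "GL_over C =
     {h. (\<forall>i j. h $ i $ j \<in> C) \<and>
         (\<exists>h'. (\<forall>i j. h' $ i $ j \<in> C) \<and> h ** h' = mat 1 \<and> h' ** h = mat 1)}"

definition affine_group :: "'a::field set \<Rightarrow> (('a ^ 'n ^ 'n) \<times> ('a ^ 'n)) set" where
  "affine_group C = GL_over C \<times> {h0. \<forall>i. h0 $ i \<in> C}"

text \<open>
  An element \<open>f\<close> of the field of differential rational functions is written as a quotient of two
  differential polynomials, and \<open>f\<langle>hx + h0\<rangle>\<close> is obtained by replacing \<open>x\<close> by \<open>hx + h0\<close> in both.
  If \<open>C\<close> is a field of constants and the components of \<open>x\<close> are differentially algebraically
  independent over \<open>C\<close>, then so are the components of \<open>hx + h0\<close>; hence the new denominator does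
  not vanish and the result does not depend on the chosen quotient.
\<close>

definition affine_invariants ::
  "('a::field \<Rightarrow> 'a) \<Rightarrow> 'a set \<Rightarrow> 'a ^ 'n \<Rightarrow> 'a set" where
  "affine_invariants d C x =
     {diff_eval d p x / diff_eval d q x | p q.
        p \<in> mpol_over C UNIV \<and> q \<in> mpol_over C UNIV \<and> diff_eval d q x \<noteq> 0 \<and>
        (\<forall>(h, h0) \<in> affine_group C.
           diff_eval d p (h *v x + h0) / diff_eval d q (h *v x + h0) =
           diff_eval d p x / diff_eval d q x)}"

end

theory Submission
  imports Defs "HOL-Computational_Algebra.Polynomial"
begin

text \<open>
  Let \<open>W\<close> be the matrix with columns \<open>dx, \<dots>, d\<^sup>nx\<close>. Under \<open>x \<mapsto> hx + h\<^sub>0\<close> with constant \<open>h, h\<^sub>0\<close>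
  it becomes \<open>hW\<close>, so \<open>W\<^sup>-\<^sup>1 d\<^sup>jx\<close> is invariant for every \<open>j > n\<close>, and \<open>d\<^sup>jx = W (W\<^sup>-\<^sup>1 d\<^sup>jx)\<close>
  lies in the field generated over the invariants by the jets of order at most \<open>n\<close>.

  For independence, a polynomial relation \<open>p\<close> with invariant coefficients among these jets
  persists after every substitution \<open>x \<mapsto> hx + h\<^sub>0\<close> over \<open>C\<close>. As \<open>C\<close> is infinite, the resulting
  polynomial in \<open>(h, h\<^sub>0)\<close> vanishes for all \<open>h, h\<^sub>0\<close> over the ambient field; there
  \<open>(hx + h\<^sub>0, hW)\<close> takes every value because \<open>W\<close> is invertible. Hence \<open>p\<close> vanishes identically.
\<close>

section \<open>Polynomial functions\<close>

definition monom_eval :: "('v \<Rightarrow> 'a::comm_ring_1) \<Rightarrow> ('v \<Rightarrow>\<^sub>0 nat) \<Rightarrow> 'a" where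
  "monom_eval z m = (\<Prod>v\<in>Poly_Mapping.keys m. z v ^ Poly_Mapping.lookup m v)"

lemma mpol_eval_monom_eval:
  "mpol_eval z p = (\<Sum>m\<in>Poly_Mapping.keys p. Poly_Mapping.lookup p m * monom_eval z m)"
  by (simp add: mpol_eval_def monom_eval_def)

lemma monom_eval_superset:
  assumes "finite A" "Poly_Mapping.keys m \<subseteq> A"
  shows "monom_eval z m = (\<Prod>v\<in>A. z v ^ Poly_Mapping.lookup m v)"
  unfolding monom_eval_def
  by (rule prod.mono_neutral_left) (use assms in \<open>auto simp: in_keys_iff\<close>)

lemma mpol_eval_superset:
  assumes "finite A" "Poly_Mapping.keys p \<subseteq> A"
  shows "mpol_eval z p = (\<Sum>m\<in>A. Poly_Mapping.lookup p m * monom_eval z m)"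
  unfolding mpol_eval_monom_eval
  by (rule sum.mono_neutral_left) (use assms in \<open>auto simp: in_keys_iff\<close>)

lemma monom_eval_zero [simp]: "monom_eval z 0 = 1"
  by (simp add: monom_eval_def)

lemma monom_eval_one [simp]: "monom_eval (\<lambda>_. 1) m = 1"
  by (simp add: monom_eval_def)

lemma monom_eval_add: "monom_eval z (m + m') = monom_eval z m * monom_eval z m'"
proof -
  let ?A = "Poly_Mapping.keys m \<union> Poly_Mapping.keys m'"
  have "monom_eval z (m + m') = (\<Prod>v\<in>?A. z v ^ Poly_Mapping.lookup (m + m') v)"
    by (rule monom_eval_superset) (use Poly_Mapping.keys_add[of m m'] in auto)
  then show ?thesis
    by (simp add: monom_eval_superset[of ?A m] monom_eval_superset[of ?A m'] lookup_add power_add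
        prod.distrib)
qed

lemma monom_eval_mult: "monom_eval (\<lambda>v. w v * z v) m = monom_eval w m * monom_eval z m"
  by (simp add: monom_eval_def power_mult_distrib prod.distrib)

lemma monom_eval_single [simp]: "monom_eval z (Poly_Mapping.single v k) = z v ^ k"
  by (simp add: monom_eval_superset[of "{v}"])

lemma mpol_eval_zero [simp]: "mpol_eval z 0 = 0"
  by (simp add: mpol_eval_def)

lemma mpol_eval_add: "mpol_eval z (p + q) = mpol_eval z p + mpol_eval z q"
proof -
  let ?A = "Poly_Mapping.keys p \<union> Poly_Mapping.keys q"
  have "mpol_eval z (p + q) = (\<Sum>m\<in>?A. Poly_Mapping.lookup (p + q) m * monom_eval z m)"
    by (rule mpol_eval_superset) (use Poly_Mapping.keys_add[of p q] in auto)
  then show ?thesis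
    by (simp add: mpol_eval_superset[of ?A p] mpol_eval_superset[of ?A q] lookup_add
        distrib_right sum.distrib)
qed

lemma mpol_eval_single [simp]: "mpol_eval z (Poly_Mapping.single m c) = c * monom_eval z m"
  by (simp add: mpol_eval_superset[of "{m}"])

text \<open>Linear independence of distinct multiplicative characters, applied to monomials.\<close>

lemma monom_eval_independent:
  fixes c :: "('v \<Rightarrow>\<^sub>0 nat) \<Rightarrow> 'a::field_char_0"
  assumes "finite S" "\<And>z. (\<Sum>m\<in>S. c m * monom_eval z m) = 0" "m \<in> S"
  shows "c m = 0"
  using assms
proof (induction S arbitrary: c m rule: finite_induct)
  case empty
  then show ?case by simp
next
  case (insert m0 S)
  have *: "c m' = 0" if m': "m' \<in> S" for m'
  proof -
    have "m' \<noteq> m0" using insert m' by auto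
    then obtain v where v: "Poly_Mapping.lookup m' v \<noteq> Poly_Mapping.lookup m0 v"
      by (meson poly_mapping_eqI)
    \<comment> \<open>Doubling only the coordinate \<open>v\<close> separates the two monomials:
      their values at \<open>w\<close> are distinct powers of 2, which stay distinct in
      characteristic zero.\<close>
    define w :: "'v \<Rightarrow> 'a" where "w = (\<lambda>u. if u = v then 2 else 1)"
    have w: "monom_eval w m = 2 ^ Poly_Mapping.lookup m v" for m
    proof -
      have "monom_eval w m = (\<Prod>u\<in>insert v (Poly_Mapping.keys m). w u ^ Poly_Mapping.lookup m u)"
        by (rule monom_eval_superset) auto
      also have "\<dots> = (\<Prod>u\<in>{v}. w u ^ Poly_Mapping.lookup m u)"
        by (rule prod.mono_neutral_right) (auto simp: w_def)
      finally show ?thesis by (simp add: w_def)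
    qed
    have "(2::nat) ^ Poly_Mapping.lookup m' v \<noteq> 2 ^ Poly_Mapping.lookup m0 v"
      using v by simp
    then have "(of_nat (2 ^ Poly_Mapping.lookup m' v) :: 'a) \<noteq> of_nat (2 ^ Poly_Mapping.lookup m0 v)"
      by (simp only: of_nat_eq_iff not_False_eq_True)
    then have ne: "monom_eval w m' \<noteq> monom_eval w m0"
      by (simp add: w)
    \<comment> \<open>Substituting \<open>w v * z v\<close> for \<open>z v\<close> and subtracting
      \<open>monom_eval w m0\<close> times the original relation cancels the \<open>m0\<close> term,
      leaving a relation over \<open>S\<close>.\<close>
    have "(\<Sum>m\<in>S. (c m * (monom_eval w m - monom_eval w m0)) * monom_eval z m) = 0" for z
    proof -
      have "(\<Sum>m\<in>S. (c m * (monom_eval w m - monom_eval w m0)) * monom_eval z m)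
        = (\<Sum>m\<in>insert m0 S. c m * monom_eval (\<lambda>v. w v * z v) m)
          - monom_eval w m0 * (\<Sum>m\<in>insert m0 S. c m * monom_eval z m)"
        using insert.hyps
        by (simp add: monom_eval_mult sum_subtractf sum_distrib_left algebra_simps)
      then show ?thesis using insert.prems(1) by simp
    qed
    from insert.IH[OF this m'] ne show ?thesis by simp
  qed
  \<comment> \<open>At the all-ones point every monomial is 1, so only \<open>c m0\<close>
    survives.\<close>
  have "c m0 = 0"
    using insert.prems(1)[of "\<lambda>_. 1"] insert.hyps * by simp
  with * insert.prems(2) show ?case by auto
qed

text \<open>The coefficients on the finite support vanish by independence of the monomials. This
  turns identical vanishing of a relation into \<open>p = 0\<close>.\<close>

lemma mpol_eq_zero_if_eval_zero:
  fixes p :: "('v, 'a::field_char_0) mpol"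
  assumes "\<And>z. mpol_eval z p = 0"
  shows "p = 0"
proof -
  have "Poly_Mapping.lookup p m = 0" if "m \<in> Poly_Mapping.keys p" for m
    by (rule monom_eval_independent[OF finite_keys _ that])
      (use assms in \<open>simp add: mpol_eval_monom_eval\<close>)
  then have "Poly_Mapping.lookup p m = 0" for m
    by (cases "m \<in> Poly_Mapping.keys p") (simp_all add: in_keys_iff)
  then show ?thesis
    by (simp add: poly_mapping_eqI)
qed

section \<open>Polynomial functions with coefficients in a subfield\<close>

text \<open>Functions instead of formal polynomials: products, substitutions and determinants are
  then pointwise, while membership still records where the coefficients lie.\<close>

definition polyfun :: "'a::comm_ring_1 set \<Rightarrow> (('v \<Rightarrow> 'a) \<Rightarrow> 'a) set" where
  "polyfun L = {\<lambda>z. mpol_eval z p | p. p \<in> mpol_over L UNIV}"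

lemma polyfun_add:
  assumes "is_subfield L" "f \<in> polyfun L" "g \<in> polyfun L"
  shows "(\<lambda>z. f z + g z) \<in> polyfun L"
proof -
  from assms obtain p q where "f = (\<lambda>z. mpol_eval z p)" "g = (\<lambda>z. mpol_eval z q)"
    "p \<in> mpol_over L UNIV" "q \<in> mpol_over L UNIV"
    by (auto simp: polyfun_def)
  with assms(1) show ?thesis
    unfolding polyfun_def
    by (auto intro!: exI[of _ "p + q"] simp: mpol_eval_add mpol_over_def lookup_add is_subfield_def)
qed

lemma polyfun_monom:
  assumes "is_subfield L" "c \<in> L"
  shows "(\<lambda>z. c * monom_eval z m) \<in> polyfun L"
  using assms unfolding polyfun_def
  by (auto intro!: exI[of _ "Poly_Mapping.single m c"]
      simp: mpol_over_def lookup_single when_def is_subfield_def)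

lemma polyfun_const:
  assumes "is_subfield L" "c \<in> L"
  shows "(\<lambda>z. c) \<in> polyfun L"
  using polyfun_monom[OF assms, of 0] by simp

lemma polyfun_var:
  assumes "is_subfield L"
  shows "(\<lambda>z. z v) \<in> polyfun L"
  using polyfun_monom[OF assms, of 1 "Poly_Mapping.single v 1"] assms
  by (simp add: is_subfield_def)

lemma polyfun_sum:
  assumes "is_subfield L" "\<And>i. i \<in> A \<Longrightarrow> f i \<in> polyfun L"
  shows "(\<lambda>z. \<Sum>i\<in>A. f i z) \<in> polyfun L"
  using assms(2)
proof (induction A rule: infinite_finite_induct)
  case (insert x A)
  then show ?case using polyfun_add[OF assms(1), of "f x" "\<lambda>z. \<Sum>i\<in>A. f i z"] by simp
qed (use assms(1) polyfun_const[of L 0] in \<open>simp_all add: is_subfield_def\<close>)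

lemma polyfun_mult:
  assumes "is_subfield L" "f \<in> polyfun L" "g \<in> polyfun L"
  shows "(\<lambda>z. f z * g z) \<in> polyfun L"
proof -
  from assms obtain p q where pq: "f = (\<lambda>z. mpol_eval z p)" "g = (\<lambda>z. mpol_eval z q)"
    "\<And>m. Poly_Mapping.lookup p m \<in> L" "\<And>m. Poly_Mapping.lookup q m \<in> L"
    by (auto simp: polyfun_def mpol_over_def)
  have "(\<lambda>z. f z * g z) =
    (\<lambda>z. \<Sum>m\<in>Poly_Mapping.keys p. \<Sum>m'\<in>Poly_Mapping.keys q.
      (Poly_Mapping.lookup p m * Poly_Mapping.lookup q m') * monom_eval z (m + m'))"
    unfolding pq mpol_eval_monom_eval sum_product
    by (simp add: monom_eval_add mult_ac)
  also have "\<dots> \<in> polyfun L"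
    by (intro polyfun_sum polyfun_monom assms(1))
      (use assms(1) pq in \<open>auto simp: is_subfield_def\<close>)
  finally show ?thesis .
qed

lemma polyfun_prod:
  assumes "is_subfield L" "\<And>i. i \<in> A \<Longrightarrow> f i \<in> polyfun L"
  shows "(\<lambda>z. \<Prod>i\<in>A. f i z) \<in> polyfun L"
  using assms(2)
proof (induction A rule: infinite_finite_induct)
  case (insert x A)
  then show ?case using polyfun_mult[OF assms(1), of "f x" "\<lambda>z. \<Prod>i\<in>A. f i z"] by simp
qed (use assms(1) polyfun_const[of L 1] in \<open>simp_all add: is_subfield_def\<close>)

lemma polyfun_power:
  assumes "is_subfield L" "f \<in> polyfun L"
  shows "(\<lambda>z. f z ^ k) \<in> polyfun L"
  using polyfun_prod[OF assms(1), of "{..<k}" "\<lambda>_. f"] assms(2) by simp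

lemma polyfun_monom_eval:
  assumes "is_subfield L"
  shows "(\<lambda>z. monom_eval z m) \<in> polyfun L"
  using polyfun_monom[OF assms, of 1 m] assms by (simp add: is_subfield_def)

lemma polyfun_compose:
  assumes "is_subfield L" "f \<in> polyfun L" "\<And>v. (\<lambda>z. g z v) \<in> polyfun L"
  shows "(\<lambda>z. f (g z)) \<in> polyfun L"
proof -
  from assms(2) obtain p where p: "f = (\<lambda>z. mpol_eval z p)" "\<And>m. Poly_Mapping.lookup p m \<in> L"
    by (auto simp: polyfun_def mpol_over_def)
  show ?thesis
    unfolding p(1) mpol_eval_def
    by (intro polyfun_sum polyfun_mult polyfun_prod polyfun_power polyfun_const assms p(2))
qed

lemma polyfun_det:
  fixes M :: "('v \<Rightarrow> 'a::field) \<Rightarrow> 'a ^ 'n ^ 'n"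
  assumes L: "is_subfield L" and M: "\<And>i j. (\<lambda>z. M z $ i $ j) \<in> polyfun L"
  shows "(\<lambda>z. det (M z)) \<in> polyfun L"
proof -
  \<comment> \<open>The signs in the Leibniz formula are 1 or -1, so they lie in every
    subfield.\<close>
  have "of_int (sign \<pi>) \<in> L" for \<pi> :: "'n \<Rightarrow> 'n"
    using L by (auto simp: sign_def is_subfield_def)
  then show ?thesis
    unfolding det_def
    by (intro polyfun_sum polyfun_mult polyfun_prod polyfun_const L M)
qed

section \<open>Vanishing of polynomial functions\<close>

lemma is_subfield_UNIV: "is_subfield UNIV"
  by (simp add: is_subfield_def)

lemma polyfun_line:
  assumes "f \<in> polyfun UNIV"
  shows "\<exists>q. \<forall>t. f (\<lambda>v. a v + t * b v) = poly q t"
proof -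
  from assms obtain p where p: "f = (\<lambda>z. mpol_eval z p)"
    by (auto simp: polyfun_def)
  \<comment> \<open>Each variable \<open>v\<close> is replaced by the linear polynomial with
    constant term \<open>a v\<close> and slope \<open>b v\<close>.\<close>
  let ?q = "\<Sum>m\<in>Poly_Mapping.keys p. [:Poly_Mapping.lookup p m:] *
       (\<Prod>v\<in>Poly_Mapping.keys m. [:a v, b v:] ^ Poly_Mapping.lookup m v)"
  have "f (\<lambda>v. a v + t * b v) = poly ?q t" for t
    by (simp add: p mpol_eval_def poly_sum poly_prod)
  then show ?thesis by blast
qed

lemma poly_eq_zero_infinite:
  fixes q :: "'a::idom poly"
  assumes "infinite A" "\<And>t. t \<in> A \<Longrightarrow> poly q t = 0"
  shows "q = 0"
proof (rule ccontr)
  assume "q \<noteq> 0"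
  then have "finite {t. poly q t = 0}" by (rule poly_roots_finite)
  with assms show False by (metis (mono_tags, lifting) finite_subset mem_Collect_eq subsetI)
qed

text \<open>On the line from \<open>a\<close> (at t = 0) to \<open>b\<close> (at t = 1) both
  functions become univariate polynomials over a field, where a zero product with a nonzero factor
  forces the other factor to vanish.\<close>

lemma polyfun_zero_divisor:
  fixes f g :: "('v \<Rightarrow> 'a::field_char_0) \<Rightarrow> 'a"
  assumes f: "f \<in> polyfun UNIV" and g: "g \<in> polyfun UNIV"
    and fg: "\<And>z. f z * g z = 0" and b: "g b \<noteq> 0"
  shows "f a = 0"
proof -
  let ?l = "\<lambda>t v. a v + t * (b v - a v)"
  obtain p where p: "\<And>t. f (?l t) = poly p t" using polyfun_line[OF f, of a "\<lambda>v. b v - a v"] by blast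
  obtain q where q: "\<And>t. g (?l t) = poly q t" using polyfun_line[OF g, of a "\<lambda>v. b v - a v"] by blast
  have "poly (p * q) t = 0" for t
    using fg[of "?l t"] by (simp add: p q)
  then have "p * q = 0" using poly_all_0_iff_0 by blast
  moreover have "q \<noteq> 0" using q[of 1] b by auto
  ultimately have "p = 0" by simp
  with p[of 0] show ?thesis by simp
qed

text \<open>The coordinates are released from \<open>C\<close> one at a time: as a function of a
  single coordinate, \<open>f\<close> is a univariate polynomial with infinitely many zeros. The set
  \<open>A\<close> in the induction holds the coordinates already released.\<close>

lemma polyfun_dense:
  fixes f :: "('v::finite \<Rightarrow> 'a::field_char_0) \<Rightarrow> 'a"
  assumes f: "f \<in> polyfun UNIV" and C: "infinite C"
    and zero: "\<And>z. range z \<subseteq> C \<Longrightarrow> f z = 0"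
  shows "f z = 0"
proof -
  have "\<forall>z. z ` (- A) \<subseteq> C \<longrightarrow> f z = 0" if "finite A" for A
    using that
  proof (induction A rule: finite_induct)
    case empty
    then show ?case using zero by simp
  next
    case (insert v A)
    show ?case
    proof (intro allI impI)
      fix z assume z: "z ` (- insert v A) \<subseteq> C"
      \<comment> \<open>The base point has coordinate 0 at \<open>v\<close>, so the parameter
        \<open>t\<close> is itself the value of that coordinate.\<close>
      let ?l = "\<lambda>t u. (z(v := 0)) u + t * (if u = v then 1 else 0)"
      obtain q where q: "\<And>t. f (?l t) = poly q t"
        using polyfun_line[OF f, of "z(v := 0)" "\<lambda>u. if u = v then 1 else 0"] by blast
      have l: "?l t = z(v := t)" for t by auto
      have "poly q t = 0" if "t \<in> C" for t
      proof -
        have "(z(v := t)) ` (- A) \<subseteq> C" using z that by auto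
        then show ?thesis using insert.IH q[of t] by (simp only: l)
      qed
      then have "q = 0" by (rule poly_eq_zero_infinite[OF C])
      then show "f z = 0" using q[of "z v"] by (simp only: l fun_upd_triv poly_0)
    qed
  qed
  from this[of UNIV] show ?thesis by simp
qed

lemma polyfun_ex:
  "(\<exists>f\<in>polyfun L. P f) \<longleftrightarrow> (\<exists>p\<in>mpol_over L UNIV. P (\<lambda>z. mpol_eval z p))"
  by (auto simp: polyfun_def)

text \<open>Specialisation principle: an independent family is a generic point, so whatever
  polynomial identity over \<open>L\<close> holds there holds at every point.\<close>

lemma alg_indep_over_polyfun:
  assumes "alg_indep_over L UNIV y" "f \<in> polyfun L" "f y = 0"
  shows "f z = 0"
  using assms by (auto simp: alg_indep_over_def polyfun_def)

section \<open>Subfields and constants\<close>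

lemma is_subfield_constants:
  assumes d: "is_derivation d" and F: "is_subfield F"
  shows "is_subfield (constants d F)"
proof -
  have add: "d (a + b) = d a + d b" and mult: "d (a * b) = d a * b + a * d b" for a b
    using d by (auto simp: is_derivation_def)
  have 0: "d 0 = 0" using mult[of 0 0] by simp
  have 1: "d 1 = 0" using mult[of 1 1] by (simp only: mult_1_left mult_1_right add_cancel_right_right)
  have neg: "d (- a) = - d a" for a
    using add[of a "- a"] 0 by (simp add: eq_neg_iff_add_eq_0 add.commute)
  \<comment> \<open>For nonzero \<open>a\<close> this comes from differentiating
    \<open>a * inverse a = 1\<close>; for \<open>a = 0\<close> the inverse is 0 by
    convention.\<close>
  have inv: "d (inverse a) = 0" if "d a = 0" for a
    using mult[of a "inverse a"] that 0 1 by (cases "a = 0") auto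
  show ?thesis
    using F by (auto simp: is_subfield_def constants_def add mult 0 1 neg inv)
qed

lemma infinite_subfield:
  fixes L :: "'a::field_char_0 set"
  assumes "is_subfield L"
  shows "infinite L"
proof -
  have "of_nat k \<in> L" for k
    using assms by (induction k) (auto simp: is_subfield_def)
  then have "range of_nat \<subseteq> L" by auto
  moreover have "infinite (range (of_nat :: nat \<Rightarrow> 'a))"
    by (simp add: finite_image_iff inj_of_nat)
  ultimately show ?thesis using finite_subset by blast
qed

lemma is_subfield_sum:
  assumes "is_subfield L" "\<And>i. i \<in> A \<Longrightarrow> f i \<in> L"
  shows "sum f A \<in> L"
  using assms by (induction A rule: infinite_finite_induct) (auto simp: is_subfield_def)

lemma is_subfield_prod:
  assumes "is_subfield L" "\<And>i. i \<in> A \<Longrightarrow> f i \<in> L"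
  shows "prod f A \<in> L"
  using assms by (induction A rule: infinite_finite_induct) (auto simp: is_subfield_def)

lemma is_subfield_det:
  fixes A :: "'a::field ^ 'n ^ 'n"
  assumes L: "is_subfield L" and A: "\<And>i j. A $ i $ j \<in> L"
  shows "det A \<in> L"
proof -
  have mult: "a * b \<in> L" if "a \<in> L" "b \<in> L" for a b
    using L that by (simp add: is_subfield_def)
  have "of_int (sign \<pi>) \<in> L" for \<pi> :: "'n \<Rightarrow> 'n"
    using L by (auto simp: sign_def is_subfield_def)
  then show ?thesis
    unfolding det_def by (intro is_subfield_sum mult is_subfield_prod L A)
qed

lemma is_subfield_power:
  assumes "is_subfield L" "a \<in> L"
  shows "a ^ k \<in> L"
  using is_subfield_prod[OF assms(1), of "{..<k}" "\<lambda>_. a"] assms(2) by simp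

lemma is_subfield_divide:
  assumes "is_subfield L" "a \<in> L" "b \<in> L"
  shows "a / b \<in> L"
  using assms by (simp add: is_subfield_def divide_inverse)

lemma polyfun_in_subfield:
  assumes L: "is_subfield L" and "C \<subseteq> L" and z: "\<And>v. z v \<in> L" and f: "f \<in> polyfun C"
  shows "f z \<in> L"
proof -
  from f obtain p where p: "f = (\<lambda>z. mpol_eval z p)" "\<And>m. Poly_Mapping.lookup p m \<in> C"
    by (auto simp: polyfun_def mpol_over_def)
  have mult: "a * b \<in> L" if "a \<in> L" "b \<in> L" for a b
    using L that by (simp add: is_subfield_def)
  show ?thesis
    unfolding p(1) mpol_eval_def
    by (intro is_subfield_sum mult is_subfield_prod is_subfield_power L z) (use p assms(2) in auto)
qed

text \<open>A nonzero determinant gives an inverse over the ambient field. Cramer's rule writes its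
  entries as quotients of determinants over \<open>L\<close>, so the inverse has entries in
  \<open>L\<close> too.\<close>

lemma GL_overI:
  fixes h :: "'a::field ^ 'n ^ 'n"
  assumes L: "is_subfield L" and h: "\<And>i j. h $ i $ j \<in> L" and det: "det h \<noteq> 0"
  shows "h \<in> GL_over L"
proof -
  \<comment> \<open>\<open>c j\<close> is the Cramer solution of \<open>h *v c j = axis j 1\<close>,
    that is, column \<open>j\<close> of the inverse.\<close>
  define c :: "'n \<Rightarrow> 'a ^ 'n"
    where "c j = (\<chi> k. det (\<chi> i l. if l = k then axis j 1 $ i else h $ i $ l) / det h)" for j
  have hc: "h *v c j = axis j 1" for j
    by (simp add: cramer[OF det] c_def)
  define h' where "h' = (\<chi> k j. c j $ k)"
  have "(h ** h') $ i $ j = (h *v c j) $ i" for i j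
    by (simp add: h'_def matrix_matrix_mult_def matrix_vector_mult_def)
  then have "h ** h' = mat 1"
    by (simp add: hc axis_def mat_def vec_eq_iff)
  moreover from this have "h' ** h = mat 1"
    by (simp add: matrix_left_right_inverse)
  moreover have "h' $ i $ j \<in> L" for i j
  proof -
    have "0 \<in> L" "1 \<in> L" using L by (auto simp: is_subfield_def)
    then show ?thesis
      unfolding h'_def c_def
      by (auto intro!: is_subfield_divide[OF L] is_subfield_det[OF L] simp: h axis_def)
  qed
  ultimately show ?thesis
    using h by (auto simp: GL_over_def)
qed

lemma adjoin_minimal:
  assumes "is_subfield T" "L \<subseteq> T" "S \<subseteq> T"
  shows "adjoin L S \<subseteq> T"
  unfolding adjoin_def using assms by (simp add: hull_minimal)

lemma in_adjoinI:
  assumes "\<And>T. is_subfield T \<Longrightarrow> L \<subseteq> T \<Longrightarrow> S \<subseteq> T \<Longrightarrow> a \<in> T"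
  shows "a \<in> adjoin L S"
  using assms by (auto simp: adjoin_def hull_def)

section \<open>The action of the affine group on jets\<close>

text \<open>For constant \<open>h\<close> and \<open>h0\<close> this is the effect of the
  substitution \<open>h *v x + h0\<close> on jets; the translation reaches order 0 only. It is
  defined on arbitrary points and matrices because the independence proof lets \<open>h\<close> and
  \<open>h0\<close> range over the whole ambient field.\<close>

definition jet_action ::
  "'a::comm_ring_1 ^ 'n ^ 'n \<Rightarrow> 'a ^ 'n \<Rightarrow> ('n \<times> nat \<Rightarrow> 'a) \<Rightarrow> 'n \<times> nat \<Rightarrow> 'a" where
  "jet_action h h0 z = (\<lambda>(i, j). (\<Sum>l\<in>UNIV. h $ i $ l * z (l, j)) + (if j = 0 then h0 $ i else 0))"

text \<open>Column \<open>l\<close> carries the derivatives of order \<open>\<sigma> l\<close>. An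
  enumeration of the orders 1 to n gives the matrix W; changing \<open>\<sigma>\<close> at one index
  gives the numerators of Cramer's rule.\<close>

definition jet_matrix :: "('n \<Rightarrow> nat) \<Rightarrow> ('n \<times> nat \<Rightarrow> 'a) \<Rightarrow> 'a ^ 'n ^ 'n" where
  "jet_matrix \<sigma> z = (\<chi> i l. z (i, \<sigma> l))"

lemma jet_matrix_action:
  assumes "\<And>l. \<sigma> l > 0"
  shows "jet_matrix \<sigma> (jet_action h h0 z) = h ** jet_matrix \<sigma> z"
  using assms
  by (simp add: jet_matrix_def jet_action_def matrix_matrix_mult_def vec_eq_iff less_imp_neq[symmetric])

text \<open>The pair \<open>(h', - (h' *v h0))\<close> is the inverse affine map; for each fixed
  order \<open>j\<close> the claim is an identity between vectors.\<close>

lemma jet_action_inverse: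
  fixes h h' :: "'a::comm_ring_1 ^ 'n ^ 'n"
  assumes "h ** h' = mat 1"
  shows "jet_action h h0 (jet_action h' (- (h' *v h0)) z) = z"
proof (rule ext, clarify)
  fix i j
  let ?v = "\<chi> l. z (l, j)"
  have "jet_action h h0 (jet_action h' (- (h' *v h0)) z) (i, j)
      = (h *v (h' *v ?v - (if j = 0 then h' *v h0 else 0)) + (if j = 0 then h0 else 0)) $ i"
    by (simp add: jet_action_def matrix_vector_mult_def)
  also have "\<dots> = ?v $ i"
    by (simp add: matrix_vector_mult_diff_distrib matrix_vector_mul_assoc assms)
  finally show "jet_action h h0 (jet_action h' (- (h' *v h0)) z) (i, j) = z (i, j)"
    by simp
qed

lemma det_jet_matrix_polyfun:
  assumes "is_subfield L"
  shows "(\<lambda>z. det (jet_matrix \<sigma> z)) \<in> polyfun L"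
  by (rule polyfun_det[OF assms]) (simp add: jet_matrix_def polyfun_var[OF assms])

section \<open>The generic jet and its images under the group\<close>

locale jet_setting =
  fixes d :: "'k::field_char_0 \<Rightarrow> 'k" and C :: "'k set" and x :: "'k ^ 'n"
  assumes derivation: "is_derivation d"
    and subfield: "is_subfield C"
    and const: "c \<in> C \<Longrightarrow> d c = 0"
    and indep: "alg_indep_over C UNIV (jet d x)"
begin

lemma d_add: "d (a + b) = d a + d b"
  and d_mult: "d (a * b) = d a * b + a * d b"
  using derivation by (auto simp: is_derivation_def)

lemma d_zero: "d 0 = 0"
  using d_add[of 0 0] by simp

lemma d_sum: "d (sum f A) = (\<Sum>i\<in>A. d (f i))"
  by (induction A rule: infinite_finite_induct) (simp_all add: d_add d_zero)

text \<open>Constants pass through \<open>d\<close>, so each derivative acts on \<open>x\<close>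
  alone, and the first derivative kills the translation.\<close>

lemma jet_affine:
  assumes h: "\<And>i j. h $ i $ j \<in> C" and h0: "\<And>i. h0 $ i \<in> C"
  shows "jet d (h *v x + h0) = jet_action h h0 (jet d x)"
proof (rule ext, clarify)
  fix i j
  show "jet d (h *v x + h0) (i, j) = jet_action h h0 (jet d x) (i, j)"
  proof (induction j)
    case 0
    then show ?case by (simp add: jet_def jet_action_def matrix_vector_mult_def)
  next
    case (Suc j)
    have "jet d (h *v x + h0) (i, Suc j) = d (jet d (h *v x + h0) (i, j))"
      by (simp only: jet_def prod.case funpow.simps o_apply)
    also have "\<dots> = d (jet_action h h0 (jet d x) (i, j))"
      by (simp only: Suc)
    also have "\<dots> = jet_action h h0 (jet d x) (i, Suc j)"
      by (simp add: jet_action_def d_add d_sum d_mult const h h0 d_zero jet_def)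
    finally show ?case .
  qed
qed

lemma polyfun_jet_zero: "f \<in> polyfun C \<Longrightarrow> f (jet d x) = 0 \<Longrightarrow> f z = 0"
  by (rule alg_indep_over_polyfun[OF indep])

text \<open>The composite of \<open>f\<close> with the action has coefficients in \<open>C\<close>.
  If it vanished at the generic jet it would vanish everywhere, in particular at the preimage of the
  generic jet, where its value is \<open>f (jet d x)\<close>.\<close>

lemma polyfun_jet_action_nonzero:
  assumes g: "(h, h0) \<in> affine_group C" and f: "f \<in> polyfun C" "f (jet d x) \<noteq> 0"
  shows "f (jet_action h h0 (jet d x)) \<noteq> 0"
proof
  assume zero: "f (jet_action h h0 (jet d x)) = 0"
  from g obtain h' where h': "h ** h' = mat 1" and hC: "\<And>i j. h $ i $ j \<in> C" "\<And>i. h0 $ i \<in> C"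
    by (auto simp: affine_group_def GL_over_def)
  have "(\<lambda>z. jet_action h h0 z v) \<in> polyfun C" for v
  proof (cases v)
    case (Pair i j)
    have "(if j = 0 then h0 $ i else 0) \<in> C"
      using hC subfield by (simp add: is_subfield_def)
    then show ?thesis
      unfolding Pair jet_action_def prod.case
      by (intro polyfun_add polyfun_sum polyfun_mult polyfun_const polyfun_var subfield hC)
  qed
  from polyfun_jet_zero[OF polyfun_compose[OF subfield f(1) this] zero]
  have "f (jet_action h h0 (jet_action h' (- (h' *v h0)) (jet d x))) = 0" .
  with f(2) show False by (simp add: jet_action_inverse[OF h'])
qed

lemma det_jet_matrix_nonzero:
  assumes "inj \<sigma>"
  shows "det (jet_matrix \<sigma> (jet d x)) \<noteq> 0"
proof
  assume "det (jet_matrix \<sigma> (jet d x)) = 0"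
  \<comment> \<open>Specialising the jets so that the matrix becomes the identity; injectivity of
    \<open>\<sigma>\<close> makes its off-diagonal entries 0.\<close>
  then have "det (jet_matrix \<sigma> (\<lambda>(i, j). if j = \<sigma> i then 1 else 0 :: 'k)) = 0"
    by (rule polyfun_jet_zero[OF det_jet_matrix_polyfun[OF subfield]])
  moreover have "jet_matrix \<sigma> (\<lambda>(i, j). if j = \<sigma> i then 1 else 0 :: 'k) = mat 1"
    using assms by (auto simp: jet_matrix_def mat_def vec_eq_iff inj_eq)
  ultimately show False by (simp add: det_I)
qed

section \<open>Differential rational functions and affine invariants\<close>

lemma diff_rational_functions_iff:
  "a \<in> diff_rational_functions d C x \<longleftrightarrow>
    (\<exists>f\<in>polyfun C. \<exists>g\<in>polyfun C. g (jet d x) \<noteq> 0 \<and> a = f (jet d x) / g (jet d x))"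
  unfolding polyfun_ex by (auto simp: diff_rational_functions_def diff_eval_def)

lemma affine_invariants_iff:
  "a \<in> affine_invariants d C x \<longleftrightarrow>
    (\<exists>f\<in>polyfun C. \<exists>g\<in>polyfun C. g (jet d x) \<noteq> 0 \<and> a = f (jet d x) / g (jet d x) \<and>
      (\<forall>h h0. (h, h0) \<in> affine_group C \<longrightarrow>
        f (jet_action h h0 (jet d x)) / g (jet_action h h0 (jet d x)) = a))"
proof -
  have "jet d (h *v x + h0) = jet_action h h0 (jet d x)" if "(h, h0) \<in> affine_group C" for h h0
    using that by (intro jet_affine) (auto simp: affine_group_def GL_over_def)
  then have *: "(\<forall>(h, h0) \<in> affine_group C. P h h0 (jet d (h *v x + h0))) \<longleftrightarrow>
      (\<forall>h h0. (h, h0) \<in> affine_group C \<longrightarrow> P h h0 (jet_action h h0 (jet d x)))" for P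
    by auto
  show ?thesis
    unfolding polyfun_ex affine_invariants_def diff_eval_def
    unfolding *[of "\<lambda>h h0 z. mpol_eval z p / mpol_eval z q = a" for p q a]
    by auto
qed

lemma is_subfield_diff_rational_functions: "is_subfield (diff_rational_functions d C x)"
proof -
  let ?D = "diff_rational_functions d C x"
  let ?X = "jet d x"
  \<comment> \<open>When \<open>g\<close> vanishes at the jet, the quotient is 0 by the convention
    for division and is represented as 0/1. The closure proofs, inversion of 0 included, can thus
    skip checking denominators.\<close>
  have quotI: "f ?X / g ?X \<in> ?D" if "f \<in> polyfun C" "g \<in> polyfun C" for f g
  proof (cases "g ?X = 0")
    case True
    have "(0 :: 'k) \<in> C" "(1 :: 'k) \<in> C" using subfield by (auto simp: is_subfield_def)
    then show ?thesis
      unfolding diff_rational_functions_iff using True polyfun_const[OF subfield]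
      by (intro bexI[of _ "\<lambda>_. 0"] bexI[of _ "\<lambda>_. 1"]) auto
  next
    case False
    then show ?thesis
      unfolding diff_rational_functions_iff using that by blast
  qed
  have constI: "c \<in> ?D" if "c \<in> C" for c
  proof -
    have "(1 :: 'k) \<in> C" using subfield by (auto simp: is_subfield_def)
    then show ?thesis
      using quotI[OF polyfun_const[OF subfield that] polyfun_const[OF subfield, of 1]] by simp
  qed
  have C: "0 \<in> C" "1 \<in> C" "- 1 \<in> C" using subfield by (auto simp: is_subfield_def)
  have mult: "a * b \<in> ?D" if ab: "a \<in> ?D" "b \<in> ?D" for a b
  proof -
    from ab obtain f g f' g' where "f \<in> polyfun C" "g \<in> polyfun C" "a = f ?X / g ?X"
      "f' \<in> polyfun C" "g' \<in> polyfun C" "b = f' ?X / g' ?X"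
      unfolding diff_rational_functions_iff by blast
    then show ?thesis
      using quotI[OF polyfun_mult[OF subfield, of f f'] polyfun_mult[OF subfield, of g g']] by simp
  qed
  have add: "a + b \<in> ?D" if ab: "a \<in> ?D" "b \<in> ?D" for a b
  proof -
    from ab obtain f g f' g' where fg: "f \<in> polyfun C" "g \<in> polyfun C" "a = f ?X / g ?X" "g ?X \<noteq> 0"
      "f' \<in> polyfun C" "g' \<in> polyfun C" "b = f' ?X / g' ?X" "g' ?X \<noteq> 0"
      unfolding diff_rational_functions_iff by blast
    have "(\<lambda>z. f z * g' z + f' z * g z) \<in> polyfun C" "(\<lambda>z. g z * g' z) \<in> polyfun C"
      by (intro polyfun_add polyfun_mult subfield fg)+
    from quotI[OF this] show ?thesis
      using fg by (simp add: add_frac_eq)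
  qed
  have inv: "inverse a \<in> ?D" if a: "a \<in> ?D" for a
  proof -
    from a obtain f g where "f \<in> polyfun C" "g \<in> polyfun C" "a = f ?X / g ?X"
      unfolding diff_rational_functions_iff by blast
    then show ?thesis
      using quotI[of g f] by simp
  qed
  have neg: "- a \<in> ?D" if a: "a \<in> ?D" for a
    using mult[OF constI[OF C(3)] a] by simp
  show ?thesis
    by (simp add: is_subfield_def constI C add mult inv neg)
qed

lemma constants_subset_affine_invariants: "C \<subseteq> affine_invariants d C x"
proof
  fix c assume "c \<in> C"
  moreover have "1 \<in> C" using subfield by (simp add: is_subfield_def)
  ultimately show "c \<in> affine_invariants d C x"
    unfolding affine_invariants_iff using polyfun_const[OF subfield]
    by (intro bexI[of _ "\<lambda>_. c"] bexI[of _ "\<lambda>_. 1"]) auto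
qed

section \<open>Generation by the jets of order at most n\<close>

lemma jet_matrix_quotient_invariant:
  fixes \<sigma> \<tau> :: "'n \<Rightarrow> nat"
  assumes \<sigma>: "inj \<sigma>" "\<And>l. \<sigma> l > 0" and \<tau>: "\<And>l. \<tau> l > 0"
  shows "det (jet_matrix \<tau> (jet d x)) / det (jet_matrix \<sigma> (jet d x)) \<in> affine_invariants d C x"
proof -
  have "det h \<noteq> 0" if "(h, h0) \<in> affine_group C" for h h0
  proof -
    from that obtain h' where "h ** h' = mat 1"
      by (auto simp: affine_group_def GL_over_def)
    then have "det h * det h' = 1" by (metis det_I det_mul)
    then show ?thesis by auto
  qed
  then show ?thesis
    unfolding affine_invariants_iff
    by (intro bexI[OF _ det_jet_matrix_polyfun[OF subfield, of \<tau>]]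
        bexI[OF _ det_jet_matrix_polyfun[OF subfield, of \<sigma>]])
      (auto simp: det_jet_matrix_nonzero \<sigma> \<tau> jet_matrix_action det_mul)
qed

text \<open>By Cramer's rule the coordinates of \<open>d\<^sup>jx\<close> with respect to the columns of \<open>W\<close> are quotients of
  determinants, both of which the affine group multiplies by \<open>det h\<close>.\<close>

lemma jet_combination:
  fixes \<sigma> :: "'n \<Rightarrow> nat"
  assumes \<sigma>: "inj \<sigma>" "\<And>l. \<sigma> l > 0" and j: "j > 0"
  obtains c where "\<And>l. c l \<in> affine_invariants d C x"
    "\<And>i. jet d x (i, j) = (\<Sum>l\<in>UNIV. jet d x (i, \<sigma> l) * c l)"
proof -
  let ?W = "jet_matrix \<sigma> (jet d x)"
  let ?b = "\<chi> i. jet d x (i, j)"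
  define c where "c = (\<lambda>l. det (jet_matrix (\<sigma>(l := j)) (jet d x)) / det ?W)"
  \<comment> \<open>Changing \<open>\<sigma>\<close> at \<open>l\<close> replaces column
    \<open>l\<close> by the vector of derivatives of order \<open>j\<close>. If \<open>j\<close> is
    already the order of another column, two columns agree and \<open>c l\<close> is 0.\<close>
  have "jet_matrix (\<sigma>(l := j)) (jet d x) = (\<chi> i k. if k = l then ?b $ i else ?W $ i $ k)" for l
    by (simp add: jet_matrix_def vec_eq_iff)
  then have "?W *v (\<chi> l. c l) = ?b"
    by (simp add: cramer[OF det_jet_matrix_nonzero[OF \<sigma>(1)]] c_def)
  then have "jet d x (i, j) = (?W *v (\<chi> l. c l)) $ i" for i
    by simp
  then have "jet d x (i, j) = (\<Sum>l\<in>UNIV. jet d x (i, \<sigma> l) * c l)" for i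
    by (simp add: matrix_vector_mult_def jet_matrix_def)
  moreover have "c l \<in> affine_invariants d C x" for l
    unfolding c_def by (rule jet_matrix_quotient_invariant) (use \<sigma> j in auto)
  ultimately show ?thesis using that by blast
qed

lemma ex_column_indexing:
  obtains \<sigma> :: "'n \<Rightarrow> nat" where "inj \<sigma>" "\<And>l. \<sigma> l > 0" "range \<sigma> = {1..CARD('n)}"
proof -
  obtain \<tau> :: "'n \<Rightarrow> nat" where \<tau>: "bij_betw \<tau> UNIV {0..<CARD('n)}"
    using ex_bij_betw_finite_nat[OF finite_class.finite_UNIV] by blast
  have "range (Suc \<circ> \<tau>) = Suc ` range \<tau>" by (simp add: image_comp)
  also have "\<dots> = {1..CARD('n)}"
    using \<tau> by (simp add: bij_betw_def image_Suc_atLeastLessThan atLeastLessThanSuc_atLeastAtMost)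
  finally show ?thesis
    using \<tau> by (intro that[of "Suc \<circ> \<tau>"]) (auto simp: bij_betw_def inj_def)
qed

text \<open>One inclusion holds because the differential rational functions form a field containing
  all generators. For the other, a field containing the generators contains every jet: order 0 is a
  generator, and higher orders are combinations of the columns of W with invariant
  coefficients.\<close>

lemma adjoin_jets:
  "diff_rational_functions d C x =
    adjoin (affine_invariants d C x) {(d ^^ j) (x $ i) | i j. j \<le> CARD('n)}"
proof
  have one: "(\<lambda>_. 1) \<in> polyfun C"
    by (rule polyfun_const[OF subfield]) (use subfield in \<open>simp add: is_subfield_def\<close>)
  have "jet d x v \<in> diff_rational_functions d C x" for v
    unfolding diff_rational_functions_iff
    by (intro bexI[OF _ polyfun_var[OF subfield, of v]] bexI[OF _ one]) simp
  then have "(d ^^ j) (x $ i) \<in> diff_rational_functions d C x" for i j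
    by (metis jet_def prod.case)
  moreover have "affine_invariants d C x \<subseteq> diff_rational_functions d C x"
    unfolding subset_iff affine_invariants_iff diff_rational_functions_iff by blast
  ultimately show "adjoin (affine_invariants d C x) {(d ^^ j) (x $ i) | i j. j \<le> CARD('n)}
      \<subseteq> diff_rational_functions d C x"
    by (intro adjoin_minimal is_subfield_diff_rational_functions) auto
next
  show "diff_rational_functions d C x
      \<subseteq> adjoin (affine_invariants d C x) {(d ^^ j) (x $ i) | i j. j \<le> CARD('n)}"
  proof (intro subsetI in_adjoinI)
    fix a T
    assume a: "a \<in> diff_rational_functions d C x" and T: "is_subfield T"
      and inv: "affine_invariants d C x \<subseteq> T"
      and low: "{(d ^^ j) (x $ i) | i j. j \<le> CARD('n)} \<subseteq> T"
    have low: "jet d x (i, j) \<in> T" if "j \<le> CARD('n)" for i j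
      using low that by (auto simp: jet_def)
    obtain \<sigma> :: "'n \<Rightarrow> nat"
      where \<sigma>: "inj \<sigma>" "\<And>l. \<sigma> l > 0" "range \<sigma> = {1..CARD('n)}" using ex_column_indexing by blast
    have \<sigma>le: "\<sigma> l \<le> CARD('n)" for l
      using \<sigma>(3) by auto
    have mult: "b * c \<in> T" if "b \<in> T" "c \<in> T" for b c
      using T that by (simp add: is_subfield_def)
    have jets: "jet d x v \<in> T" for v
    proof (cases v)
      case (Pair i j)
      show ?thesis
      proof (cases "j = 0")
        case True
        then show ?thesis by (simp add: Pair low)
      next
        case False
        then obtain c where c: "\<And>l. c l \<in> affine_invariants d C x"
          "\<And>i. jet d x (i, j) = (\<Sum>l\<in>UNIV. jet d x (i, \<sigma> l) * c l)"
          using jet_combination[OF \<sigma>(1,2), of j] by blast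
        have "(\<Sum>l\<in>UNIV. jet d x (i, \<sigma> l) * c l) \<in> T"
          by (intro is_subfield_sum[OF T] mult low \<sigma>le) (use c(1) inv in auto)
        then show ?thesis by (simp add: Pair c(2))
      qed
    qed
    from a obtain f g where fg: "f \<in> polyfun C" "g \<in> polyfun C" "a = f (jet d x) / g (jet d x)"
      unfolding diff_rational_functions_iff by blast
    have "C \<subseteq> T" using constants_subset_affine_invariants inv by blast
    then show "a \<in> T"
      unfolding fg(3)
      by (intro is_subfield_divide[OF T] polyfun_in_subfield[OF T _ jets fg(1)]
          polyfun_in_subfield[OF T _ jets fg(2)])
  qed
qed

section \<open>Algebraic independence over the invariants\<close>

text \<open>Clearing denominators yields a polynomial \<open>R\<close> over \<open>C\<close> that
  vanishes at the generic jet, hence everywhere. At the moved jet the coefficients are unchanged and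
  the denominators are nonzero, so the relation itself vanishes there.\<close>

lemma invariant_relation:
  assumes p: "p \<in> mpol_over (affine_invariants d C x) I" and zero: "mpol_eval (jet d x) p = 0"
    and g: "(h, h0) \<in> affine_group C"
  shows "mpol_eval (jet_action h h0 (jet d x)) p = 0"
proof -
  let ?X = "jet d x"
  let ?S = "Poly_Mapping.keys p"
  let ?gX = "jet_action h h0 ?X"
  have "Poly_Mapping.lookup p m \<in> affine_invariants d C x" for m
    using p by (simp add: mpol_over_def)
  then have "\<exists>P Q. P \<in> polyfun C \<and> Q \<in> polyfun C \<and> Q ?X \<noteq> 0 \<and> Poly_Mapping.lookup p m = P ?X / Q ?X \<and>
      P ?gX / Q ?gX = Poly_Mapping.lookup p m" for m
    unfolding affine_invariants_iff using g by metis
  then obtain P Q where PQ: "\<And>m. P m \<in> polyfun C" "\<And>m. Q m \<in> polyfun C" "\<And>m. Q m ?X \<noteq> 0"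
    "\<And>m. P m ?X / Q m ?X = Poly_Mapping.lookup p m"
    "\<And>m. P m ?gX / Q m ?gX = Poly_Mapping.lookup p m"
    by metis
  define R where
    "R z = (\<Sum>m\<in>?S. P m z * (\<Prod>m'\<in>?S - {m}. Q m' z) * monom_eval z m)" for z
  \<comment> \<open>The hypotheses hold at exactly the two points of interest, \<open>?X\<close> and
    \<open>?gX\<close>: at both, \<open>P m / Q m\<close> is the coefficient of
    \<open>m\<close>.\<close>
  have R_eq: "R z = (\<Prod>m\<in>?S. Q m z) * mpol_eval z p"
    if Qz: "\<And>m. Q m z \<noteq> 0" and Pz: "\<And>m. P m z / Q m z = Poly_Mapping.lookup p m" for z
  proof -
    have "P m z * (\<Prod>m'\<in>?S - {m}. Q m' z) = (\<Prod>m\<in>?S. Q m z) * Poly_Mapping.lookup p m"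
      if "m \<in> ?S" for m
      using Qz[of m] by (simp add: Pz[of m, symmetric] prod.remove[OF finite_keys that])
    then show ?thesis
      unfolding R_def mpol_eval_monom_eval sum_distrib_left
      by (intro sum.cong) (simp_all add: mult.assoc)
  qed
  have Q: "Q m ?gX \<noteq> 0" for m
    by (rule polyfun_jet_action_nonzero[OF g PQ(2,3)])
  have "R \<in> polyfun C"
    unfolding R_def
    by (intro polyfun_sum polyfun_mult polyfun_prod polyfun_monom_eval subfield PQ)
  moreover have "R ?X = 0"
    using R_eq[of ?X] PQ zero by simp
  ultimately have "R ?gX = 0" by (rule polyfun_jet_zero)
  then show ?thesis
    using R_eq[of ?gX] PQ(5) Q by simp
qed

lemma alg_indep_jets:
  "alg_indep_over (affine_invariants d C x) {(i, j). j \<le> CARD('n)} (jet d x)"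
  unfolding alg_indep_over_def
proof (intro ballI impI)
  let ?X = "jet d x"
  fix p
  assume p: "p \<in> mpol_over (affine_invariants d C x) {(i :: 'n, j). j \<le> CARD('n)}"
    and zero: "mpol_eval ?X p = 0"
  \<comment> \<open>The unknown affine map is one family \<open>u\<close>: \<open>Some l\<close>
    indexes matrix entries, \<open>None\<close> the translation. The resulting \<open>f\<close> has
    coefficients in the ambient field, since they involve the jets of \<open>x\<close>.\<close>
  define H :: "('n \<times> 'n option \<Rightarrow> 'k) \<Rightarrow> 'k ^ 'n ^ 'n" where "H u = (\<chi> i l. u (i, Some l))" for u
  define H0 :: "('n \<times> 'n option \<Rightarrow> 'k) \<Rightarrow> 'k ^ 'n" where "H0 u = (\<chi> i. u (i, None))" for u
  define f where "f u = mpol_eval (jet_action (H u) (H0 u) ?X) p" for u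
  have "(\<lambda>z. mpol_eval z p) \<in> polyfun UNIV"
    by (auto simp: polyfun_def mpol_over_def)
  moreover have "(\<lambda>u. jet_action (H u) (H0 u) ?X v) \<in> polyfun UNIV" for v
  proof (cases v)
    case (Pair i j)
    have *: "(\<lambda>u :: 'n \<times> 'n option \<Rightarrow> 'k. if j = 0 then u (i, None) else 0) \<in> polyfun UNIV"
      using polyfun_var[OF is_subfield_UNIV, of "(i, None)"]
        polyfun_const[OF is_subfield_UNIV UNIV_I, of 0]
      by (cases "j = 0") auto
    show ?thesis
      unfolding Pair jet_action_def prod.case H_def H0_def vec_lambda_beta
      by (intro polyfun_add polyfun_sum polyfun_mult polyfun_const polyfun_var is_subfield_UNIV * UNIV_I)
  qed
  ultimately have f: "f \<in> polyfun UNIV"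
    unfolding f_def by (rule polyfun_compose[OF is_subfield_UNIV])
  have g: "(\<lambda>u. det (H u)) \<in> polyfun UNIV"
    by (rule polyfun_det[OF is_subfield_UNIV]) (simp add: H_def polyfun_var[OF is_subfield_UNIV])
  \<comment> \<open>The factor \<open>det (H u)\<close> covers the singular matrices over
    \<open>C\<close>, to which the invariance says nothing. It is cancelled afterwards, being
    nonzero at the identity.\<close>
  have "f u * det (H u) = 0" for u
  proof (rule polyfun_dense[OF polyfun_mult[OF is_subfield_UNIV f g] infinite_subfield[OF subfield]])
    fix u :: "'n \<times> 'n option \<Rightarrow> 'k" assume u: "range u \<subseteq> C"
    show "f u * det (H u) = 0"
    proof (cases "det (H u) = 0")
      case False
      then have "H u \<in> GL_over C"
        by (intro GL_overI[OF subfield]) (use u in \<open>auto simp: H_def\<close>)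
      then have "(H u, H0 u) \<in> affine_group C"
        using u by (auto simp: affine_group_def H0_def)
      then show ?thesis
        unfolding f_def by (simp add: invariant_relation[OF p zero])
    qed simp
  qed
  moreover have "det (H (\<lambda>(i, l). if l = Some i then 1 else 0)) \<noteq> 0"
  proof -
    have "H (\<lambda>(i, l). if l = Some i then 1 else 0) = mat 1"
      by (auto simp: H_def mat_def vec_eq_iff)
    then show ?thesis by (simp add: det_I)
  qed
  ultimately have f0: "f u = 0" for u
    by (rule polyfun_zero_divisor[OF f g])
  obtain \<sigma> :: "'n \<Rightarrow> nat"
    where \<sigma>: "inj \<sigma>" "\<And>l. \<sigma> l > 0" "range \<sigma> = {1..CARD('n)}" using ex_column_indexing by blast
  let ?W = "jet_matrix \<sigma> ?X"
  obtain V where V: "V ** ?W = mat 1"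
    using det_jet_matrix_nonzero[OF \<sigma>(1)] invertible_det_nz[of ?W] by (auto simp: invertible_def)
  have "mpol_eval z p = 0" for z
  proof -
    \<comment> \<open>Since \<open>V\<close> inverts W, this \<open>h\<close> carries W to the
      matrix of derivatives prescribed by \<open>z\<close>; \<open>h0\<close> then corrects order
      0.\<close>
    define h where "h = jet_matrix \<sigma> z ** V"
    define h0 where "h0 = (\<chi> i. z (i, 0) - (\<Sum>l\<in>UNIV. h $ i $ l * ?X (l, 0)))"
    have hW: "jet_matrix \<sigma> (jet_action h h0 ?X) = jet_matrix \<sigma> z"
      by (simp add: jet_matrix_action[OF \<sigma>(2)] h_def matrix_mul_assoc[symmetric] V)
    have agree: "jet_action h h0 ?X (i, j) = z (i, j)" if j: "j \<le> CARD('n)" for i j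
    proof (cases "j = 0")
      case True
      then show ?thesis by (simp add: jet_action_def h0_def)
    next
      case False
      with j have "j \<in> range \<sigma>" by (simp add: \<sigma>(3))
      then obtain l where "j = \<sigma> l" by blast
      with hW show ?thesis by (simp add: jet_matrix_def vec_eq_iff)
    qed
    \<comment> \<open>The moved jet is matched with \<open>z\<close> up to order n only, and these
      are the only variables occurring in \<open>p\<close>.\<close>
    have "mpol_eval z p = mpol_eval (jet_action h h0 ?X) p"
      unfolding mpol_eval_def
    proof (intro sum.cong refl arg_cong2[of _ _ _ _ "(*)"] prod.cong)
      fix m v assume "m \<in> Poly_Mapping.keys p" "v \<in> Poly_Mapping.keys m"
      with p have "v \<in> {(i, j). j \<le> CARD('n)}" by (auto simp: mpol_over_def)
      then show "z v ^ Poly_Mapping.lookup m v = jet_action h h0 ?X v ^ Poly_Mapping.lookup m v"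
        by (auto simp: agree)
    qed
    also have "\<dots> = f (\<lambda>(i, l). case l of None \<Rightarrow> h0 $ i | Some l \<Rightarrow> h $ i $ l)"
      by (simp add: f_def H_def H0_def)
    finally show ?thesis by (simp add: f0)
  qed
  then show "p = 0" by (rule mpol_eq_zero_if_eval_zero)
qed

end

theorem theorem3:
  fixes d :: "'k::field_char_0 \<Rightarrow> 'k"
    and F C :: "'k set"
    and x :: "'k ^ 'n"
  assumes "is_derivation d"
    and "is_subfield F" and "\<And>a. a \<in> F \<Longrightarrow> d a \<in> F"
    and "C = constants d F" and "C \<noteq> F"
    and "CARD('n) > 1"
    and "diff_alg_indep d F x"
  shows "alg_indep_over (affine_invariants d C x) {(i, j). j \<le> CARD('n)} (jet d x) \<and>
    diff_rational_functions d C x =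
      adjoin (affine_invariants d C x) {(d ^^ j) (x $ i) | i j. j \<le> CARD('n)}"
proof -
  interpret jet_setting d C x
  proof
    show "is_subfield C" using assms by (simp add: is_subfield_constants)
    \<comment> \<open>A relation over \<open>C\<close> is also one over \<open>F\<close>, so
      independence passes down to the constants.\<close>
    have "mpol_over C UNIV \<subseteq> (mpol_over F UNIV :: ('n \<times> nat, 'k) mpol set)"
      using assms(4) by (auto simp: mpol_over_def constants_def)
    then show "alg_indep_over C UNIV (jet d x)"
      using assms(7) by (auto simp: diff_alg_indep_def alg_indep_over_def)
  qed (use assms in \<open>simp_all add: constants_def\<close>)
  show ?thesis using alg_indep_jets adjoin_jets by blast
qed

end
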